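(* Let $ABC$ be a triangle with circumcircle $\Omega$, let $P$ be a point with isogonal conjugate $P'$ with respect to $ABC$, and let $D$ be the intersection of $\Omega$ with the conic $(ABCPP')$ other than $A,B,C$. Let $X$ be the second intersection of line $DP$ with $\Omega$ and $Y$ the second intersection of line $DP'$ with $\Omega$. Let the circle $(PXY)$ meet line $PP'$ again at $Z$. (a) The circle $(PXY)$ and the conic $(ABCPZ)$ are tangent at $P$ and at $Z$. (b) Let the circle $(PXY)$ meet the conic $(ABCPX)$ at the points $Z_1, Z_2$ (other than $P, X$). Let lines $XZ_1, XZ_2$ meet $\Omega$ again at $Z_1', Z_2'$ respectively. Then line $Z_1'Z_2'$ is tangent to the conic $(ABCPP')$ at $P'$.
   Context: For points $X,Y,Z$, $(XYZ)$ denotes the circle through them; for five points $V,W,X,Y,Z$, $(VWXYZ)$ denotes the conic through them. *)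

theory Defs
  imports "HOL-Analysis.Analysis"
begin

text \<open>Points of the real plane are complex numbers.  A conic (or circle) is given by the
coefficients (a,b,c,d,e,f) of  a x^2 + b x y + c y^2 + d x + e y + f = 0.\<close>

type_synonym conic = "real \<times> real \<times> real \<times> real \<times> real \<times> real"

definition on_conic :: "conic \<Rightarrow> complex \<Rightarrow> bool" where
  "on_conic K z = (case K of (a,b,c,d,e,f) \<Rightarrow>
     a * (Re z)^2 + b * Re z * Im z + c * (Im z)^2 + d * Re z + e * Im z + f = 0)"

definition is_conic :: "conic \<Rightarrow> bool" where
  "is_conic K = (case K of (a,b,c,d,e,f) \<Rightarrow> (a,b,c) \<noteq> (0,0,0))"

definition is_circle :: "conic \<Rightarrow> bool" where
  "is_circle K = (case K of (a,b,c,d,e,f) \<Rightarrow> a \<noteq> 0 \<and> a = c \<and> b = 0 \<and> d^2 + e^2 > 4*a*f)"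

definition conic_scale :: "real \<Rightarrow> conic \<Rightarrow> conic" where
  "conic_scale t K = (case K of (a,b,c,d,e,f) \<Rightarrow> (t*a,t*b,t*c,t*d,t*e,t*f))"

definition conic_grad :: "conic \<Rightarrow> complex \<Rightarrow> complex" where
  "conic_grad K z = (case K of (a,b,c,d,e,f) \<Rightarrow>
     Complex (2*a*Re z + b*Im z + d) (b*Re z + 2*c*Im z + e))"

definition unique_conic5 :: "complex \<Rightarrow> complex \<Rightarrow> complex \<Rightarrow> complex \<Rightarrow> complex \<Rightarrow> bool" where
  "unique_conic5 p1 p2 p3 p4 p5 =
     ((\<exists>K. is_conic K \<and> (\<forall>p\<in>{p1,p2,p3,p4,p5}. on_conic K p)) \<and>
      (\<forall>K1 K2. is_conic K1 \<and> is_conic K2 \<and> (\<forall>p\<in>{p1,p2,p3,p4,p5}. on_conic K1 p) \<and>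
               (\<forall>p\<in>{p1,p2,p3,p4,p5}. on_conic K2 p) \<longrightarrow> (\<exists>t. t \<noteq> 0 \<and> K2 = conic_scale t K1)))"

text \<open>Two curves are tangent at p: both pass through p and their gradients at p are
  linearly dependent (intersection multiplicity at least 2).\<close>
definition curves_tangent_at :: "conic \<Rightarrow> conic \<Rightarrow> complex \<Rightarrow> bool" where
  "curves_tangent_at K1 K2 p = (on_conic K1 p \<and> on_conic K2 p \<and>
      Im (cnj (conic_grad K1 p) * conic_grad K2 p) = 0)"

definition line_tangent_at :: "complex \<Rightarrow> complex \<Rightarrow> conic \<Rightarrow> complex \<Rightarrow> bool" where
  "line_tangent_at u v K p = (u \<noteq> v \<and> collinear {u, v, p} \<and> on_conic K p \<and>
      Re (cnj (conic_grad K p) * (v - u)) = 0)"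

definition reflect_line :: "complex \<Rightarrow> complex \<Rightarrow> complex \<Rightarrow> complex" where
  "reflect_line Q w z = Q + (w / cnj w) * cnj (z - Q)"

definition bisector_dir :: "complex \<Rightarrow> complex \<Rightarrow> complex \<Rightarrow> complex" where
  "bisector_dir V U W = (U - V) / of_real (cmod (U - V)) + (W - V) / of_real (cmod (W - V))"

definition isogonal_conj :: "complex \<Rightarrow> complex \<Rightarrow> complex \<Rightarrow> complex \<Rightarrow> complex \<Rightarrow> bool" where
  "isogonal_conj A B C P P' =
     (collinear {A, reflect_line A (bisector_dir A B C) P, P'} \<and>
      collinear {B, reflect_line B (bisector_dir B C A) P, P'} \<and>
      collinear {C, reflect_line C (bisector_dir C A B) P, P'})"

end

theory Submission
  imports Defs
begin

text \<open>After a similarity, \<open>\<Omega>\<close> is the unit circle and \<open>D = 1\<close>. Write \<open>z~\<close> for the conjugate of \<open>z\<close> and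
\<open>s1, s2, s3\<close> for the elementary symmetric functions of the vertices; then isogonal conjugates \<open>p\<close>, \<open>q\<close>
satisfy \<open>p + q + s3 p~ q~ = s1\<close>. Let \<open>\<alpha>\<close> and \<open>\<beta>\<close> be the coefficients of \<open>z^2\<close> and \<open>z z~\<close> in the equation of a
conic through the vertices. If its fourth intersection with the unit circle is \<open>d\<close>, Vieta's formulas
give \<open>\<alpha>~ = \<alpha> s3 d\<close> and determine the remaining coefficients, and the conic contains \<open>p\<close> iff
\<open>\<beta> = \<alpha> (s3 q~ + d q)\<close>. As \<open>Q\<close> contains both \<open>p\<close> and \<open>q\<close>, \<open>d = 1\<close> means \<open>s3 w~ = - w\<close> for \<open>w = p - q\<close>.

For (a), if \<open>L = 0\<close> is the line \<open>PP'\<close>, a suitable combination of \<open>\<Gamma>\<close> and \<open>L^2\<close> vanishes at the vertices;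
it has double contact with \<open>\<Gamma>\<close> at \<open>P\<close> and \<open>Z\<close>, so by uniqueness it is the conic \<open>(ABCPZ)\<close>. For (b), the
projection of \<open>\<Gamma>\<close> from \<open>X\<close> to \<open>\<Omega>\<close> is a similarity. It moves \<open>(ABCPX)\<close> to a conic that meets the unit
circle in \<open>1\<close>, another known point, \<open>Z1'\<close> and \<open>Z2'\<close>, so the sum and the product of \<open>Z1'\<close> and \<open>Z2'\<close> are
given by Vieta's formulas.\<close>

section \<open>Similarities of the complex plane\<close>

definition similarity :: "complex \<Rightarrow> complex \<Rightarrow> complex \<Rightarrow> complex" where
  "similarity m r z = m + r * z"

lemma similarity_eq_iff [simp]: "r \<noteq> 0 \<Longrightarrow> similarity m r z = similarity m r w \<longleftrightarrow> z = w"
  by (simp add: similarity_def)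

lemma similarity_inverse [simp]:
  assumes "r \<noteq> 0"
  shows "similarity (- (m / r)) (1 / r) (similarity m r z) = z"
    and "similarity m r (similarity (- (m / r)) (1 / r) z) = z"
  using assms by (simp_all add: similarity_def field_simps)

lemma similarity_diff: "similarity m r z - similarity m r w = r * (z - w)"
  by (simp add: similarity_def algebra_simps)

lemma collinear_complex_iff:
  fixes u v w :: complex
  shows "collinear {u, v, w} \<longleftrightarrow> (v - u) * cnj (w - u) = cnj (v - u) * (w - u)"
proof -
  have "collinear {u, v, w} \<longleftrightarrow> collinear {0, v - u, w - u}"
    using collinear_3[of v u w] by (simp only: NO_MATCH_def insert_commute[of u v] simp_thms)
  also have "\<dots> \<longleftrightarrow> (w - u) / (v - u) \<in> \<real>"
    by (rule collinear_iff_Reals)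
  also have "\<dots> \<longleftrightarrow> (v - u) * cnj (w - u) = cnj (v - u) * (w - u)"
    by (cases "v = u") (auto simp: Reals_cnj_iff field_simps)
  finally show ?thesis .
qed

lemma collinear_similarity:
  assumes "r \<noteq> 0"
  shows "collinear {similarity m r u, similarity m r v, similarity m r w} \<longleftrightarrow> collinear {u, v, w}"
  using assms by (simp only: collinear_complex_iff similarity_diff complex_cnj_mult)
    (simp add: mult.left_commute mult.assoc)

lemma collinear_unit_chord_iff:
  fixes d x p :: complex
  assumes "d * cnj d = 1" "x * cnj x = 1" "d \<noteq> x"
  shows "collinear {d, x, p} \<longleftrightarrow> p + d * x * cnj p = d + x"
proof -
  have "collinear {d, x, p} \<longleftrightarrow> d * x * ((x - d) * cnj (p - d)) = d * x * (cnj (x - d) * (p - d))"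
    using assms(1,2) by (auto simp: collinear_complex_iff)
  also have "\<dots> \<longleftrightarrow> (x - d) * (p + d * x * cnj p - (d + x)) = 0"
    using assms(1,2) unfolding complex_cnj_diff by algebra
  also have "\<dots> \<longleftrightarrow> p + d * x * cnj p = d + x"
    using assms(3) by simp
  finally show ?thesis .
qed

section \<open>Isogonal conjugates\<close>

lemma bisector_dir_sgn: "bisector_dir V U W = sgn (U - V) + sgn (W - V)"
  by (simp add: bisector_dir_def sgn_eq)

lemma bisector_dir_similarity:
  "bisector_dir (similarity m r V) (similarity m r U) (similarity m r W) = sgn r * bisector_dir V U W"
  by (simp add: bisector_dir_sgn similarity_diff sgn_mult distrib_left)

lemma reflect_line_similarity:
  assumes "r \<noteq> 0"
  shows "reflect_line (similarity m r V) (sgn r * w) (similarity m r z)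
    = similarity m r (reflect_line V w z)"
proof -
  have "cmod r \<noteq> 0"
    using assms by simp
  hence "sgn r * w / cnj (sgn r * w) = r / cnj r * (w / cnj w)"
    by (simp add: sgn_eq)
  thus ?thesis
    using assms by (simp only: reflect_line_def similarity_diff)
      (simp add: similarity_def distrib_left)
qed

lemma isogonal_conj_similarity:
  assumes "r \<noteq> 0"
  shows "isogonal_conj (similarity m r A) (similarity m r B) (similarity m r C)
      (similarity m r P) (similarity m r P') \<longleftrightarrow> isogonal_conj A B C P P'"
  using assms
  by (simp add: isogonal_conj_def bisector_dir_similarity reflect_line_similarity collinear_similarity)

lemma Reals_of_real_mult_iff:
  "k \<noteq> 0 \<Longrightarrow> complex_of_real k * z \<in> \<real> \<longleftrightarrow> z \<in> \<real>"
  by (simp add: complex_is_Real_iff)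

lemma unit_sum_over_cnj:
  fixes U V :: complex
  assumes "U * cnj U = 1" "V * cnj V = 1" "U + V \<noteq> 0"
  shows "(U + V) / cnj (U + V) = U * V"
proof -
  have "U + V = U * V * cnj (U + V)"
    using assms(1,2) unfolding complex_cnj_add by algebra
  moreover have "cnj (U + V) \<noteq> 0"
    using assms(3) by (simp only: complex_cnj_zero_iff not_False_eq_True)
  ultimately show ?thesis
    by (metis nonzero_divide_eq_eq)
qed

lemma bisector_dir_nonzero:
  assumes "\<not> collinear {A, B, C}"
  shows "bisector_dir A B C \<noteq> 0"
proof
  assume "bisector_dir A B C = 0"
  hence opposite: "sgn (C - A) = - sgn (B - A)"
    by (simp add: bisector_dir_sgn add_eq_0_iff)
  have polar: "z = cmod z * sgn z" for z :: complex
    by (simp add: sgn_eq)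
  have "C - A = of_real (- cmod (C - A)) * sgn (B - A)"
    using polar[of "C - A"] by (simp add: opposite)
  with polar[of "B - A"] obtain e :: complex and m n :: real where "B - A = m * e" "C - A = n * e"
    by blast
  hence "(B - A) * cnj (C - A) = cnj (B - A) * (C - A)"
    by simp
  hence "collinear {A, B, C}"
    by (simp only: collinear_complex_iff)
  thus False
    using assms by contradiction
qed

lemma collinear_reflect_bisector_iff:
  assumes "\<not> collinear {A, B, C}"
  shows "collinear {A, reflect_line A (bisector_dir A B C) P, P'} \<longleftrightarrow>
    (P - A) * (P' - A) / ((B - A) * (C - A)) \<in> \<real>"
proof -
  define U V where "U = sgn (B - A)" and "V = sgn (C - A)"
  have ne: "B \<noteq> A" "C \<noteq> A"
    using assms by (auto simp: insert_commute)
  hence UV: "U * cnj U = 1" "V * cnj V = 1"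
    by (simp_all add: U_def V_def norm_sgn flip: complex_norm_square)
  have "bisector_dir A B C / cnj (bisector_dir A B C) = U * V"
    using unit_sum_over_cnj[OF UV] bisector_dir_nonzero[OF assms]
    by (simp add: U_def V_def bisector_dir_sgn)
  hence "reflect_line A (bisector_dir A B C) P - A = U * V * cnj (P - A)"
    by (simp add: reflect_line_def)
  hence "collinear {A, reflect_line A (bisector_dir A B C) P, P'} \<longleftrightarrow>
      U * V * cnj (P - A) * cnj (P' - A) = cnj U * cnj V * (P - A) * (P' - A)"
    by (simp add: collinear_complex_iff)
  also have "\<dots> \<longleftrightarrow> (P - A) * (P' - A) / (U * V) = cnj ((P - A) * (P' - A) / (U * V))"
  proof -
    have "U * V \<noteq> 0" "cnj U * cnj V \<noteq> 0"
      using UV by auto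
    thus ?thesis
      by (simp add: frac_eq_eq) (auto simp: mult_ac)
  qed
  also have "\<dots> \<longleftrightarrow> (P - A) * (P' - A) / (U * V) \<in> \<real>"
    by (auto simp: Reals_cnj_iff)
  also have "(P - A) * (P' - A) / (U * V)
      = of_real (cmod (B - A) * cmod (C - A)) * ((P - A) * (P' - A) / ((B - A) * (C - A)))"
    by (simp add: U_def V_def sgn_eq)
  also have "\<dots> \<in> \<real> \<longleftrightarrow> (P - A) * (P' - A) / ((B - A) * (C - A)) \<in> \<real>"
    using ne by (subst Reals_of_real_mult_iff) simp_all
  finally show ?thesis .
qed

section \<open>Conics in complex coordinates\<close>

definition conic_eval :: "conic \<Rightarrow> complex \<Rightarrow> real" where
  "conic_eval K z = (case K of (a,b,c,d,e,f) \<Rightarrow>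
     a * (Re z)^2 + b * Re z * Im z + c * (Im z)^2 + d * Re z + e * Im z + f)"

definition conic_quad :: "conic \<Rightarrow> complex" where
  "conic_quad K = (case K of (a,b,c,d,e,f) \<Rightarrow> Complex ((a - c) / 4) (- b / 4))"

definition conic_trace :: "conic \<Rightarrow> real" where
  "conic_trace K = (case K of (a,b,c,d,e,f) \<Rightarrow> (a + c) / 2)"

definition conic_lin :: "conic \<Rightarrow> complex" where
  "conic_lin K = (case K of (a,b,c,d,e,f) \<Rightarrow> Complex (d / 2) (- e / 2))"

definition conic_const :: "conic \<Rightarrow> real" where
  "conic_const K = (case K of (a,b,c,d,e,f) \<Rightarrow> f)"

lemmas conic_coeff_defs = conic_quad_def conic_trace_def conic_lin_def conic_const_def

lemma on_conic_iff: "on_conic K z \<longleftrightarrow> conic_eval K z = 0"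
  by (simp add: on_conic_def conic_eval_def split: prod.splits)

lemma of_real_conic_eval:
  fixes z :: complex
  shows "complex_of_real (conic_eval K z) = conic_quad K * z^2 + cnj (conic_quad K) * (cnj z)^2
      + conic_trace K * z * cnj z + conic_lin K * z + cnj (conic_lin K) * cnj z + conic_const K"
  by (simp add: conic_eval_def conic_coeff_defs complex_eq_iff power2_eq_square field_simps
      split: prod.splits)

lemma cnj_conic_grad:
  "cnj (conic_grad K z) = 2 * (2 * conic_quad K * z + conic_trace K * cnj z + conic_lin K)"
  by (simp add: conic_grad_def conic_coeff_defs complex_eq_iff field_simps split: prod.splits)

lemma is_conic_iff: "is_conic K \<longleftrightarrow> conic_quad K \<noteq> 0 \<or> conic_trace K \<noteq> 0"
  by (auto simp: is_conic_def conic_coeff_defs complex_eq_iff split: prod.splits)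

lemma is_circleD:
  assumes "is_circle K"
  shows "conic_quad K = 0" "conic_trace K \<noteq> 0"
    and "conic_trace K * conic_const K < (cmod (conic_lin K))^2"
  using assms
  by (auto simp: is_circle_def conic_coeff_defs complex_eq_iff cmod_power2 field_simps)

lemma conic_eqI:
  assumes "\<And>z. conic_eval K z = conic_eval K' z"
  shows "K = K'"
proof -
  obtain a b c d e f where K: "K = (a, b, c, d, e, f)"
    by (cases K) auto
  obtain a' b' c' d' e' f' where K': "K' = (a', b', c', d', e', f')"
    by (cases K') auto
  have "f = f'" "a + d + f = a' + d' + f'" "a - d + f = a' - d' + f'"
    "c + e + f = c' + e' + f'" "c - e + f = c' - e' + f'"
    "a + b + c + d + e + f = a' + b' + c' + d' + e' + f'"
    using assms[of 0] assms[of 1] assms[of "-1"] assms[of \<i>] assms[of "-\<i>"] assms[of "Complex 1 1"]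
    by (simp_all add: K K' conic_eval_def)
  thus ?thesis
    by (simp add: K K')
qed

lemma conic_scale_eq_scaleR: "conic_scale t K = t *\<^sub>R K"
  by (simp add: conic_scale_def scaleR_prod_def split: prod.splits)

lemma conic_eval_scaleR [simp]: "conic_eval (t *\<^sub>R K) z = t * conic_eval K z"
  by (simp add: conic_eval_def scaleR_prod_def algebra_simps split: prod.splits)

lemma conic_eval_diff [simp]: "conic_eval (K - K') z = conic_eval K z - conic_eval K' z"
  by (simp add: conic_eval_def algebra_simps split: prod.splits)

lemma conic_grad_scaleR [simp]: "conic_grad (t *\<^sub>R K) z = t *\<^sub>R conic_grad K z"
  by (simp add: conic_grad_def scaleR_prod_def complex_eq_iff algebra_simps split: prod.splits)

lemma conic_grad_diff [simp]: "conic_grad (K - K') z = conic_grad K z - conic_grad K' z"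
  by (simp add: conic_grad_def complex_eq_iff algebra_simps split: prod.splits)

lemma conic_quad_scaleR [simp]: "conic_quad (t *\<^sub>R K) = t *\<^sub>R conic_quad K"
  by (simp add: conic_quad_def scaleR_prod_def complex_eq_iff field_simps split: prod.splits)

lemma conic_quad_diff [simp]: "conic_quad (K - K') = conic_quad K - conic_quad K'"
  by (simp add: conic_quad_def complex_eq_iff field_simps split: prod.splits)

definition double_line :: "complex \<Rightarrow> complex \<Rightarrow> conic" where
  "double_line p w = (let l = - Im w; m = Re w; n = - Im (cnj w * p)
     in (l^2, 2 * l * m, m^2, 2 * l * n, 2 * m * n, n^2))"

lemma conic_eval_double_line: "conic_eval (double_line p w) z = (Im (cnj w * (z - p)))^2"
  by (simp add: conic_eval_def double_line_def Let_def power2_eq_square algebra_simps)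

lemma conic_grad_double_line:
  "conic_grad (double_line p w) z = (2 * Im (cnj w * (z - p))) *\<^sub>R (\<i> * w)"
  by (simp add: conic_grad_def double_line_def Let_def complex_eq_iff power2_eq_square algebra_simps)

lemma conic_quad_double_line: "conic_quad (double_line p w) = - ((cnj w)^2) / 4"
  by (simp add: conic_quad_def double_line_def Let_def complex_eq_iff power2_eq_square field_simps)

section \<open>Conics under similarities\<close>

definition complex_conic :: "complex \<Rightarrow> real \<Rightarrow> complex \<Rightarrow> real \<Rightarrow> conic" where
  "complex_conic \<alpha> \<beta> \<gamma> \<delta> = (\<beta> + 2 * Re \<alpha>, - 4 * Im \<alpha>, \<beta> - 2 * Re \<alpha>, 2 * Re \<gamma>, - 2 * Im \<gamma>, \<delta>)"

lemma complex_conic_coeffs [simp]: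
  "conic_quad (complex_conic \<alpha> \<beta> \<gamma> \<delta>) = \<alpha>"
  "conic_trace (complex_conic \<alpha> \<beta> \<gamma> \<delta>) = \<beta>"
  "conic_lin (complex_conic \<alpha> \<beta> \<gamma> \<delta>) = \<gamma>"
  "conic_const (complex_conic \<alpha> \<beta> \<gamma> \<delta>) = \<delta>"
  by (simp_all add: complex_conic_def conic_coeff_defs complex_eq_iff)

definition conic_pullback :: "complex \<Rightarrow> complex \<Rightarrow> conic \<Rightarrow> conic" where
  "conic_pullback m r K = complex_conic (conic_quad K * r^2) (conic_trace K * (cmod r)^2)
     (r * (conic_lin K + 2 * conic_quad K * m + conic_trace K * cnj m)) (conic_eval K m)"

lemma conic_pullback_coeffs [simp]:
  "conic_quad (conic_pullback m r K) = conic_quad K * r^2"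
  "conic_trace (conic_pullback m r K) = conic_trace K * (cmod r)^2"
  "conic_lin (conic_pullback m r K) = r * (conic_lin K + 2 * conic_quad K * m + conic_trace K * cnj m)"
  "conic_const (conic_pullback m r K) = conic_eval K m"
  by (simp_all add: conic_pullback_def)

lemma conic_eval_pullback: "conic_eval (conic_pullback m r K) z = conic_eval K (similarity m r z)"
proof -
  have "complex_of_real (conic_eval (conic_pullback m r K) z) = conic_eval K (similarity m r z)"
    unfolding of_real_conic_eval[of "conic_pullback m r K"] conic_pullback_coeffs of_real_mult
      complex_norm_square
    unfolding of_real_conic_eval similarity_def complex_cnj_add complex_cnj_mult complex_cnj_power
      complex_cnj_complex_of_real complex_cnj_cnj complex_cnj_numeral
    by algebra
  thus ?thesis
    by (simp only: of_real_eq_iff)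
qed

lemma on_conic_pullback: "on_conic (conic_pullback m r K) z \<longleftrightarrow> on_conic K (similarity m r z)"
  by (simp add: on_conic_iff conic_eval_pullback)

lemma conic_grad_pullback:
  "conic_grad (conic_pullback m r K) z = cnj r * conic_grad K (similarity m r z)"
proof -
  have "cnj (conic_grad (conic_pullback m r K) z) = r * cnj (conic_grad K (similarity m r z))"
    unfolding cnj_conic_grad conic_pullback_coeffs of_real_mult complex_norm_square similarity_def
      complex_cnj_add complex_cnj_mult by algebra
  thus ?thesis
    by (metis complex_cnj_cnj complex_cnj_mult)
qed

definition conic_image :: "complex \<Rightarrow> complex \<Rightarrow> conic \<Rightarrow> conic" where
  "conic_image m r K = conic_pullback (- (m / r)) (1 / r) K"

lemma conic_eval_image:
  "r \<noteq> 0 \<Longrightarrow> conic_eval (conic_image m r K) (similarity m r z) = conic_eval K z"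
  by (simp add: conic_image_def conic_eval_pullback)

lemma on_conic_image:
  "r \<noteq> 0 \<Longrightarrow> on_conic (conic_image m r K) (similarity m r z) \<longleftrightarrow> on_conic K z"
  by (simp add: on_conic_iff conic_eval_image)

lemma conic_image_coeffs_eq_0_iff:
  assumes "r \<noteq> 0"
  shows "conic_quad (conic_image m r K) = 0 \<longleftrightarrow> conic_quad K = 0"
    and "conic_trace (conic_image m r K) = 0 \<longleftrightarrow> conic_trace K = 0"
  using assms by (simp_all add: conic_image_def)

lemma is_conic_image: "r \<noteq> 0 \<Longrightarrow> is_conic (conic_image m r K) \<longleftrightarrow> is_conic K"
  by (simp add: is_conic_iff conic_image_coeffs_eq_0_iff)

lemma conic_grad_image:
  "r \<noteq> 0 \<Longrightarrow> cnj r * conic_grad (conic_image m r K) (similarity m r z) = conic_grad K z"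
  by (simp add: conic_image_def conic_grad_pullback)

lemma curves_tangent_at_image:
  assumes "r \<noteq> 0"
  shows "curves_tangent_at (conic_image m r K) (conic_image m r K') (similarity m r z)
    \<longleftrightarrow> curves_tangent_at K K' z"
proof -
  define g g' where "g = conic_grad (conic_image m r K) (similarity m r z)"
    and "g' = conic_grad (conic_image m r K') (similarity m r z)"
  have "cnj (conic_grad K z) * conic_grad K' z = of_real ((cmod r)^2) * (cnj g * g')"
    unfolding g_def g'_def complex_norm_square conic_grad_image[OF assms, of m _ z, symmetric]
    by simp
  hence "Im (cnj (conic_grad K z) * conic_grad K' z) = 0 \<longleftrightarrow> Im (cnj g * g') = 0"
    using assms by simp
  thus ?thesis
    by (simp only: curves_tangent_at_def on_conic_image[OF assms] g_def g'_def)
qed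

lemma line_tangent_at_image:
  assumes "r \<noteq> 0"
  shows "line_tangent_at (similarity m r u) (similarity m r v) (conic_image m r K) (similarity m r z)
    \<longleftrightarrow> line_tangent_at u v K z"
proof -
  have "cnj g * (similarity m r v - similarity m r u) = cnj (cnj r * g) * (v - u)" for g
    by (simp add: similarity_diff)
  thus ?thesis
    by (simp only: line_tangent_at_def on_conic_image[OF assms] conic_grad_image[OF assms]
        collinear_similarity[OF assms] similarity_eq_iff[OF assms])
qed

lemma conic_image_surj:
  assumes "r \<noteq> 0"
  obtains L where "K = conic_image m r L"
proof
  show "K = conic_image m r (conic_pullback m r K)"
    using assms by (intro conic_eqI) (simp add: conic_image_def conic_eval_pullback)
qed

lemma conic_image_scale: "conic_image m r (conic_scale t K) = conic_scale t (conic_image m r K)"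
  by (rule conic_eqI) (simp add: conic_scale_eq_scaleR conic_image_def conic_eval_pullback)

lemma unique_conic5_similarity:
  assumes "r \<noteq> 0" "unique_conic5 p1 p2 p3 p4 p5"
  shows "unique_conic5 (similarity m r p1) (similarity m r p2) (similarity m r p3)
    (similarity m r p4) (similarity m r p5)"
proof -
  let ?S = "{p1, p2, p3, p4, p5}"
  let ?T = "{similarity m r p1, similarity m r p2, similarity m r p3, similarity m r p4, similarity m r p5}"
  have through: "(\<forall>p\<in>?T. on_conic (conic_image m r K) p) \<longleftrightarrow> (\<forall>p\<in>?S. on_conic K p)" for K
    using assms(1) by (simp add: on_conic_image)
  show ?thesis
    unfolding unique_conic5_def
  proof (intro conjI allI impI)
    obtain K where "is_conic K" "\<forall>p\<in>?S. on_conic K p"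
      using assms(2) unfolding unique_conic5_def by blast
    thus "\<exists>K. is_conic K \<and> (\<forall>p\<in>?T. on_conic K p)"
      using through is_conic_image[OF assms(1)] by blast
  next
    fix K1 K2
    assume K: "is_conic K1 \<and> is_conic K2 \<and> (\<forall>p\<in>?T. on_conic K1 p) \<and> (\<forall>p\<in>?T. on_conic K2 p)"
    obtain L1 L2 where L: "K1 = conic_image m r L1" "K2 = conic_image m r L2"
      using conic_image_surj[OF assms(1)] by metis
    have "\<exists>t. t \<noteq> 0 \<and> L2 = conic_scale t L1"
      using K assms(2) unfolding L through is_conic_image[OF assms(1)] unique_conic5_def by blast
    thus "\<exists>t. t \<noteq> 0 \<and> K2 = conic_scale t K1"
      by (auto simp: L conic_image_scale)
  qed
qed

lemmas similarity_invariants = similarity_eq_iff collinear_similarity isogonal_conj_similarity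
  on_conic_image conic_image_coeffs_eq_0_iff is_conic_image curves_tangent_at_image line_tangent_at_image

lemma circle_similar_unit_circle:
  assumes "is_circle K" "on_conic K d"
  obtains m r where "r \<noteq> 0" "similarity m r d = 1"
    "\<And>z. on_conic K z \<longleftrightarrow> similarity m r z * cnj (similarity m r z) = 1"
proof -
  define N where "N z = conic_trace K * z + cnj (conic_lin K)" for z :: complex
  define R where "R = (cmod (conic_lin K))^2 - conic_trace K * conic_const K"
  note circle = is_circleD[OF assms(1)]
  have "conic_trace K * conic_eval K z = (cmod (N z))^2 - R" for z
  proof -
    have "complex_of_real (conic_trace K * conic_eval K z) = complex_of_real ((cmod (N z))^2 - R)"
      unfolding R_def of_real_mult of_real_diff complex_norm_square of_real_conic_eval
      by (simp add: N_def circle(1) algebra_simps)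
    thus ?thesis
      by (simp only: of_real_eq_iff)
  qed
  hence on_K: "on_conic K z \<longleftrightarrow> (cmod (N z))^2 = R" for z
    using circle(2) by (metis mult_eq_0_iff on_conic_iff right_minus_eq)
  hence N_d: "N d \<noteq> 0"
    using assms(2) circle(3) by (auto simp: R_def)
  have similarity_N: "similarity (cnj (conic_lin K) / N d) (conic_trace K / N d) z = N z / N d" for z
    by (simp add: similarity_def N_def add_divide_distrib)
  have "on_conic K z \<longleftrightarrow> N z / N d * cnj (N z / N d) = 1" for z
  proof -
    have "on_conic K z \<longleftrightarrow> complex_of_real ((cmod (N z))^2) = complex_of_real ((cmod (N d))^2)"
      using on_K assms(2) by (simp only: of_real_eq_iff)
    thus ?thesis
      using N_d unfolding complex_norm_square by simp
  qed
  thus thesis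
    using that[of "conic_trace K / N d" "cnj (conic_lin K) / N d"] N_d circle(2)
    by (simp add: similarity_N)
qed

section \<open>Conics meeting the unit circle in four points\<close>

lemma quartic_vieta:
  fixes c0 c1 c2 c3 c4 :: "'a::idom"
  assumes "distinct [r1, r2, r3, r4]"
    and roots: "\<And>z. z \<in> {r1, r2, r3, r4} \<Longrightarrow> c4 * z^4 + c3 * z^3 + c2 * z^2 + c1 * z + c0 = 0"
  shows "c3 = - c4 * (r1 + r2 + r3 + r4)"
    and "c2 = c4 * (r1 * r2 + r1 * r3 + r1 * r4 + r2 * r3 + r2 * r4 + r3 * r4)"
    and "c0 = c4 * (r1 * r2 * r3 * r4)"
proof -
  define f where "f = [:c0, c1, c2, c3, c4:]"
  define g where "g = smult c4 ([:- r1, 1:] * [:- r2, 1:] * [:- r3, 1:] * [:- r4, 1:])"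
  have "f = g"
  proof (rule poly_eqI_degree_lead_coeff)
    show "coeff f 4 = coeff g 4"
      by (simp add: f_def g_def numeral_eq_Suc)
    show "card {r1, r2, r3, r4} \<ge> 4"
      using assms(1) by simp
    show "degree f \<le> 4"
      by (simp add: f_def)
    show "degree g \<le> 4"
      by (simp add: g_def)
    show "poly f z = poly g z" if "z \<in> {r1, r2, r3, r4}" for z
      using roots[OF that] that by (auto simp: f_def g_def power_numeral_reduce algebra_simps)
  qed
  thus "c3 = - c4 * (r1 + r2 + r3 + r4)"
    "c2 = c4 * (r1 * r2 + r1 * r3 + r1 * r4 + r2 * r3 + r2 * r4 + r3 * r4)"
    "c0 = c4 * (r1 * r2 * r3 * r4)"
    by (simp_all add: f_def g_def algebra_simps)
qed

lemma conic_unit_circle_vieta: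
  assumes "distinct [r1, r2, r3, r4]"
    and "\<And>r. r \<in> {r1, r2, r3, r4} \<Longrightarrow> on_conic K r \<and> r * cnj r = 1"
  shows "conic_lin K = - conic_quad K * (r1 + r2 + r3 + r4)"
    and "conic_trace K + conic_const K
      = conic_quad K * (r1 * r2 + r1 * r3 + r1 * r4 + r2 * r3 + r2 * r4 + r3 * r4)"
    and "cnj (conic_quad K) = conic_quad K * (r1 * r2 * r3 * r4)"
proof -
  have "conic_quad K * z^4 + conic_lin K * z^3 + (conic_trace K + conic_const K) * z^2
      + cnj (conic_lin K) * z + cnj (conic_quad K) = 0" if "z \<in> {r1, r2, r3, r4}" for z :: complex
  proof -
    have "complex_of_real (conic_eval K z) = 0" and z: "z * cnj z = 1"
      using assms(2)[OF that] by (simp_all add: on_conic_iff)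
    thus ?thesis
      unfolding of_real_conic_eval of_real_add by algebra
  qed
  from quartic_vieta[OF assms(1) this]
  show "conic_lin K = - conic_quad K * (r1 + r2 + r3 + r4)"
    and "conic_trace K + conic_const K
      = conic_quad K * (r1 * r2 + r1 * r3 + r1 * r4 + r2 * r3 + r2 * r4 + r3 * r4)"
    and "cnj (conic_quad K) = conic_quad K * (r1 * r2 * r3 * r4)"
    by blast+
qed

section \<open>Isogonal conjugates in an inscribed triangle\<close>

locale inscribed_triangle =
  fixes a b c :: complex
  assumes vertices_unit: "a * cnj a = 1" "b * cnj b = 1" "c * cnj c = 1"
    and noncollinear: "\<not> collinear {a, b, c}"
begin

definition s1 :: complex where "s1 = a + b + c"
definition s2 :: complex where "s2 = a * b + b * c + c * a"
definition s3 :: complex where "s3 = a * b * c"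

definition fourth_intersection :: "conic \<Rightarrow> complex \<Rightarrow> bool" where
  "fourth_intersection K d \<longleftrightarrow>
     (\<forall>t\<in>{a, b, c, d}. on_conic K t) \<and> d * cnj d = 1 \<and> d \<notin> {a, b, c}"

lemma vertices_distinct: "a \<noteq> b" "b \<noteq> c" "c \<noteq> a"
  using noncollinear by (auto simp: insert_commute)

lemma s3_unit: "s3 * cnj s3 = 1"
  unfolding s3_def complex_cnj_mult using vertices_unit by algebra

lemma s2_eq_cnj_s1: "s2 = s3 * cnj s1"
  unfolding s1_def s2_def s3_def complex_cnj_add using vertices_unit by algebra

lemma fourth_intersection_coeffs:
  assumes "fourth_intersection K d"
  shows "conic_lin K = - conic_quad K * (d + s1)"
    and "conic_trace K + conic_const K = conic_quad K * (s2 + d * s1)"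
    and "cnj (conic_quad K) = conic_quad K * s3 * d"
proof -
  have "distinct [a, b, c, d]"
    using assms vertices_distinct by (auto simp: fourth_intersection_def)
  moreover have "on_conic K r \<and> r * cnj r = 1" if "r \<in> {a, b, c, d}" for r
    using assms vertices_unit that by (auto simp: fourth_intersection_def)
  ultimately show "conic_lin K = - conic_quad K * (d + s1)"
    and "conic_trace K + conic_const K = conic_quad K * (s2 + d * s1)"
    and "cnj (conic_quad K) = conic_quad K * s3 * d"
    using conic_unit_circle_vieta[of a b c d K] by (simp_all add: s1_def s2_def s3_def algebra_simps)
qed

lemma inscribed_triangle_rotate: "inscribed_triangle b c a"
  using vertices_unit noncollinear by unfold_locales (simp_all add: insert_commute)

lemma isogonal_at_vertex:
  assumes "collinear {a, reflect_line a (bisector_dir a b c) p, q}"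
  shows "p * q + s3 * (cnj p + cnj q) - s2 = a * (p + q + s3 * cnj p * cnj q - s1)"
proof -
  let ?v = "(b - a) * (c - a)" and ?w = "(p - a) * (q - a)"
  have "?v \<noteq> 0"
    using vertices_distinct by simp
  moreover have "?w / ?v \<in> \<real>"
    using assms collinear_reflect_bisector_iff[OF noncollinear] by simp
  ultimately have "?w * cnj ?v = cnj ?w * ?v"
    by (auto simp: Reals_cnj_iff frac_eq_eq)
  hence "?v * (p * q + s3 * (cnj p + cnj q) - s2 - a * (p + q + s3 * cnj p * cnj q - s1)) = 0"
    using vertices_unit unfolding s1_def s2_def s3_def complex_cnj_mult complex_cnj_diff by algebra
  thus ?thesis
    using \<open>?v \<noteq> 0\<close> by simp
qed

lemma isogonal_conjD:
  assumes "isogonal_conj a b c p q"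
  shows "p + q + s3 * cnj p * cnj q = s1"
proof -
  interpret bca: inscribed_triangle b c a
    by (rule inscribed_triangle_rotate)
  let ?N = "p + q + s3 * cnj p * cnj q - s1"
  have "p * q + s3 * (cnj p + cnj q) - s2 = a * ?N"
    using assms isogonal_at_vertex by (simp add: isogonal_conj_def)
  moreover have "p * q + s3 * (cnj p + cnj q) - s2 = b * ?N"
    using assms bca.isogonal_at_vertex
    by (simp add: isogonal_conj_def s1_def s2_def s3_def bca.s1_def bca.s2_def bca.s3_def ac_simps)
  ultimately have "(a - b) * ?N = 0"
    by algebra
  thus ?thesis
    using vertices_distinct by simp
qed

end

locale isogonal_pair = inscribed_triangle +
  fixes p q :: complex
  assumes isogonal: "p + q + s3 * cnj p * cnj q = s1"
begin

lemma isogonal_cnj: "p * q + s3 * (cnj p + cnj q) = s2"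
proof -
  have "cnj s1 = cnj p + cnj q + cnj s3 * p * q"
    using arg_cong[OF isogonal, of cnj] by simp
  thus ?thesis
    using s2_eq_cnj_s1 s3_unit by algebra
qed

lemma isogonal_pair_swap: "isogonal_pair a b c q p"
  using isogonal by unfold_locales (simp add: ac_simps)

lemma vertex_polynomial_eq:
  "(t - a) * (t - b) * (t - c) = t * (t - p) * (t - q) - s3 * (1 - t * cnj p) * (1 - t * cnj q)"
proof -
  have "(t - a) * (t - b) * (t - c) = t^3 - s1 * t^2 + s2 * t - s3"
    unfolding s1_def s2_def s3_def by algebra
  thus ?thesis
    using isogonal isogonal_cnj by algebra
qed

lemma conjugate_off_circle:
  assumes "\<not> collinear {a, b, p}" "\<not> collinear {b, c, p}" "\<not> collinear {c, a, p}"
  shows "q * cnj q \<noteq> 1"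
proof
  assume "q * cnj q = 1"
  hence "(q - a) * (q - b) * (q - c) = 0"
    by (simp add: vertex_polynomial_eq)
  moreover have "p + b * c * cnj p = b + c" if "q = a"
    using isogonal vertices_unit that unfolding s1_def s3_def by algebra
  moreover have "p + c * a * cnj p = c + a" if "q = b"
    using isogonal vertices_unit that unfolding s1_def s3_def by algebra
  moreover have "p + a * b * cnj p = a + b" if "q = c"
    using isogonal vertices_unit that unfolding s1_def s3_def by algebra
  ultimately show False
    using assms vertices_unit vertices_distinct by (auto simp: collinear_unit_chord_iff)
qed

lemma conic_trace_eq:
  assumes "fourth_intersection K d" "on_conic K p" "p * cnj p \<noteq> 1"
  shows "conic_trace K = conic_quad K * (s3 * cnj q + d * q)"
proof -
  note K = fourth_intersection_coeffs[OF assms(1)]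
  have d: "d * cnj d = 1"
    using assms(1) by (simp add: fourth_intersection_def)
  have cnj_lin: "cnj (- conic_quad K * (d + s1)) = - conic_quad K * (s3 + d * s2)"
    using K(3) s2_eq_cnj_s1 d unfolding complex_cnj_mult complex_cnj_minus complex_cnj_add by algebra
  have "complex_of_real (conic_eval K p)
      = (p * cnj p - 1) * (conic_trace K - conic_quad K * (s3 * cnj q + d * q))"
    using K(2) isogonal isogonal_cnj unfolding of_real_conic_eval K(1,3) cnj_lin of_real_add
    by algebra
  thus ?thesis
    using assms(2,3) by (simp add: on_conic_iff)
qed

lemma conic_quad_nonzero:
  assumes "fourth_intersection K d" "on_conic K p" "p * cnj p \<noteq> 1" "is_conic K"
  shows "conic_quad K \<noteq> 0"
  using conic_trace_eq[OF assms(1-3)] assms(4) by (auto simp: is_conic_iff)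

lemma isogonal_direction:
  assumes "fourth_intersection K d" "on_conic K p" "on_conic K q" "is_conic K"
    and "p * cnj p \<noteq> 1" "q * cnj q \<noteq> 1"
  shows "s3 * cnj (p - q) = - d * (p - q)"
proof -
  interpret swapped: isogonal_pair a b c q p
    by (rule isogonal_pair_swap)
  have "conic_quad K * (s3 * cnj q + d * q) = conic_quad K * (s3 * cnj p + d * p)"
    using conic_trace_eq swapped.conic_trace_eq assms by metis
  hence "s3 * cnj q + d * q = s3 * cnj p + d * p"
    using conic_quad_nonzero assms by simp
  thus ?thesis
    unfolding complex_cnj_diff by algebra
qed

end

section \<open>The chords through \<open>1\<close>\<close>

locale isogonal_chords = inscribed_triangle +
  fixes p q x y :: complex and Q \<Gamma> :: conic
  assumes off_sides: "\<not> collinear {a, b, p}" "\<not> collinear {b, c, p}" "\<not> collinear {c, a, p}"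
    and p_off_circle: "p * cnj p \<noteq> 1"
    and isogonal_conj: "isogonal_conj a b c p q" and p_neq_q: "p \<noteq> q"
    and Q_conic: "is_conic Q" and Q_points: "fourth_intersection Q 1" "on_conic Q p" "on_conic Q q"
    and x_unit: "x * cnj x = 1" and x_line: "collinear {1, p, x}" and x_neq_1: "x \<noteq> 1"
    and y_unit: "y * cnj y = 1" and y_line: "collinear {1, q, y}" and y_neq_1: "y \<noteq> 1"
    and pxy: "\<not> collinear {p, x, y}"
    and \<Gamma>_circle: "conic_quad \<Gamma> = 0" "conic_trace \<Gamma> \<noteq> 0"
    and \<Gamma>_points: "on_conic \<Gamma> p" "on_conic \<Gamma> x" "on_conic \<Gamma> y"
begin

sublocale isogonal_pair a b c p q
  using isogonal_conjD[OF isogonal_conj] by unfold_locales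

lemma off_circle: "p * cnj p \<noteq> 1" "q * cnj q \<noteq> 1"
  using p_off_circle conjugate_off_circle[OF off_sides] by auto

lemma x_neq_y: "x \<noteq> y"
  using pxy by auto

lemma x_chord: "p + x * cnj p = 1 + x" and y_chord: "q + y * cnj q = 1 + y"
proof -
  have "collinear {1, x, p}" "collinear {1, y, q}"
    using x_line y_line by (simp_all add: insert_commute)
  thus "p + x * cnj p = 1 + x" "q + y * cnj q = 1 + y"
    using collinear_unit_chord_iff[of 1] x_unit y_unit x_neq_1 y_neq_1 by auto
qed

definition u :: complex where "u = 1 - p"
definition v :: complex where "v = 1 - q"
definition w :: complex where "w = p - q"
definition \<sigma> :: real where "\<sigma> = 2 * Re v"
definition \<kappa> :: complex where "\<kappa> = \<sigma> - u * cnj v"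

lemmas uvw_defs = u_def v_def w_def complex_cnj_diff complex_cnj_one

lemma \<sigma>_eq: "complex_of_real \<sigma> = v + cnj v"
  by (simp add: \<sigma>_def complex_add_cnj)

lemma cnj_\<kappa>: "cnj \<kappa> = \<sigma> - cnj u * v"
  by (simp add: \<kappa>_def)

lemma x_times_cnj_u: "cnj u * x = - u" and y_times_cnj_v: "cnj v * y = - v"
  using x_chord y_chord unfolding uvw_defs by algebra+

lemma s3_times_cnj_w: "s3 * cnj w = - w"
  using isogonal_direction[OF Q_points Q_conic off_circle] by (simp add: w_def)

lemma uvw_nonzero: "u \<noteq> 0" "v \<noteq> 0" "w \<noteq> 0"
  using off_circle p_neq_q by (auto simp: u_def v_def w_def)

lemma \<sigma>_nonzero: "\<sigma> \<noteq> 0"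
proof
  assume "\<sigma> = 0"
  hence "v + cnj v = 0"
    using \<sigma>_eq by simp
  hence "cnj v * (y - 1) = 0"
    using y_times_cnj_v by algebra
  thus False
    using uvw_nonzero y_neq_1 by simp
qed

lemma \<kappa>_nonzero: "\<kappa> \<noteq> 0"
proof
  assume "\<kappa> = 0"
  hence "cnj v * (p - y) = 0"
    using y_times_cnj_v unfolding \<kappa>_def \<sigma>_eq u_def by algebra
  thus False
    using uvw_nonzero off_circle y_unit by auto
qed

lemma vertex_equation:
  assumes "t \<in> {a, b, c}"
  shows "t * cnj w * (t - p) * (t - q) + w * (1 - t * cnj p) * (1 - t * cnj q) = 0"
proof -
  have "(t - a) * (t - b) * (t - c) = 0"
    using assms by auto
  thus ?thesis
    unfolding vertex_polynomial_eq using s3_times_cnj_w by algebra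
qed

text \<open>If \<open>x\<close> were a vertex, the conic through \<open>p\<close> and \<open>q\<close> would contain the line through \<open>1\<close>, \<open>p\<close>
  and \<open>x\<close>, and then \<open>y = x\<close> as well.\<close>
lemma x_not_vertex: "x \<notin> {a, b, c}"
proof
  assume "x \<in> {a, b, c}"
  from vertex_equation[OF this] have "(x - p) * (x - p) * (1 + x - q - x * cnj q) = 0"
    using x_chord unfolding uvw_defs by algebra
  moreover have "x \<noteq> p"
    using x_unit off_circle by auto
  ultimately have "cnj v * (x - y) = 0"
    using y_chord unfolding uvw_defs by algebra
  thus False
    using uvw_nonzero x_neq_y by simp
qed

lemma \<Gamma>_coeffs:
  shows "\<sigma> * conic_lin \<Gamma> = conic_trace \<Gamma> * cnj u * cnj v"
    and "\<sigma> * (conic_trace \<Gamma> + conic_const \<Gamma>) = conic_trace \<Gamma> * (u * cnj v + cnj u * v)"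
proof -
  let ?\<beta> = "complex_of_real (conic_trace \<Gamma>)" and ?\<gamma> = "conic_lin \<Gamma>"
    and ?\<delta> = "complex_of_real (conic_const \<Gamma>)"
  have equation: "?\<beta> * z * cnj z + ?\<gamma> * z + cnj ?\<gamma> * cnj z + ?\<delta> = 0" if "on_conic \<Gamma> z" for z
    using that of_real_conic_eval[of \<Gamma> z] by (simp add: on_conic_iff \<Gamma>_circle)
  have at_x: "?\<beta> + ?\<gamma> * x + cnj ?\<gamma> * cnj x + ?\<delta> = 0"
    and at_y: "?\<beta> + ?\<gamma> * y + cnj ?\<gamma> * cnj y + ?\<delta> = 0"
    using equation[OF \<Gamma>_points(2)] equation[OF \<Gamma>_points(3)] x_unit y_unit by algebra+
  have "(x - y) * (?\<gamma> * x * y - cnj ?\<gamma>) = 0"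
    using at_x at_y x_unit y_unit by algebra
  hence cnj_lin: "cnj ?\<gamma> = ?\<gamma> * x * y"
    using x_neq_y by simp
  have const: "?\<beta> + ?\<delta> = - ?\<gamma> * (x + y)"
    using at_x cnj_lin x_unit by algebra
  have "(p * cnj p - 1) * (?\<beta> * cnj u * cnj v - ?\<gamma> * \<sigma>) = 0"
    using equation[OF \<Gamma>_points(1)] cnj_lin const x_times_cnj_u y_times_cnj_v unfolding \<sigma>_eq uvw_defs by algebra
  thus lin: "\<sigma> * ?\<gamma> = ?\<beta> * cnj u * cnj v"
    using off_circle by simp
  show "\<sigma> * (conic_trace \<Gamma> + conic_const \<Gamma>) = ?\<beta> * (u * cnj v + cnj u * v)"
    using const lin x_times_cnj_u y_times_cnj_v unfolding of_real_mult of_real_add by algebra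
qed

lemma \<Gamma>_eval:
  "\<sigma> * complex_of_real (conic_eval \<Gamma> z) = conic_trace \<Gamma> * (\<sigma> * (z * cnj z - 1)
     + cnj u * cnj v * z + u * v * cnj z + u * cnj v + cnj u * v)"
proof -
  have "\<sigma> * cnj (conic_lin \<Gamma>) = conic_trace \<Gamma> * u * v"
    using arg_cong[OF \<Gamma>_coeffs(1), of cnj] by simp
  thus ?thesis
    using \<Gamma>_coeffs unfolding of_real_conic_eval \<Gamma>_circle of_real_mult of_real_add complex_cnj_zero
    by algebra
qed

lemma \<Gamma>_eval_unit:
  assumes "t * cnj t = 1"
  shows "t * (\<sigma> * complex_of_real (conic_eval \<Gamma> t)) = conic_trace \<Gamma> * (cnj u * t + u) * (cnj v * t + v)"
  unfolding \<Gamma>_eval using assms by algebra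

lemma chord_product_at_vertex:
  assumes t: "t \<in> {a, b, c}"
  shows "t * (w * cnj w) * ((cnj u * t + u) * (cnj v * t + v))
    = - ((t * (cnj w * (t - p)) - w * (1 - t * cnj p))^2)"
proof -
  define E E' F F' where factors: "E = t - p" "E' = t - q" "F = 1 - t * cnj p" "F' = 1 - t * cnj q"
  have w: "w = E' - E" "t * cnj w = F' - F" and uv: "cnj u * t + u = E + F" "cnj v * t + v = E' + F'"
    unfolding factors uvw_defs by algebra+
  have "E' * F' * (E + F) = E * F * (E' + F')"
    using vertex_equation[OF t] w unfolding factors[symmetric] by algebra
  hence "w * (t * cnj w) * ((E + F) * (E' + F')) = - ((F' * E - E' * F)^2)"
    using w by algebra
  moreover have "F' * E - E' * F = t * cnj w * E - w * F"
    using w by algebra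
  ultimately show ?thesis
    unfolding uv factors[symmetric] by (simp add: ac_simps)
qed

lemma \<Gamma>_eval_vertex:
  assumes "t \<in> {a, b, c}"
  shows "\<sigma> * (cmod w)^2 * conic_eval \<Gamma> t = 4 * conic_trace \<Gamma> * (Im (cnj w * (t - p)))^2"
proof -
  define l where "l = Im (cnj w * (t - p))"
  have t: "t * cnj t = 1"
    using assms vertices_unit by auto
  have "cnj w * (t - p) - w * (cnj t - cnj p) = 2 * \<i> * l"
    by (simp add: l_def complex_eq_iff algebra_simps)
  hence chord: "t * (cnj w * (t - p)) - w * (1 - t * cnj p) = 2 * \<i> * l * t"
    using t by algebra
  have "t^2 * (\<sigma> * (w * cnj w) * conic_eval \<Gamma> t)
      = t * (w * cnj w) * (t * (\<sigma> * complex_of_real (conic_eval \<Gamma> t)))"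
    by (simp add: power2_eq_square)
  also have "\<dots> = conic_trace \<Gamma> * (t * (w * cnj w) * ((cnj u * t + u) * (cnj v * t + v)))"
    unfolding \<Gamma>_eval_unit[OF t] by (simp only: ac_simps)
  also have "\<dots> = - conic_trace \<Gamma> * (2 * \<i> * l * t)^2"
    unfolding chord_product_at_vertex[OF assms] chord by simp
  also have "\<dots> = t^2 * (4 * conic_trace \<Gamma> * l^2)"
    by (simp add: power_mult_distrib)
  finally have "t^2 * (\<sigma> * (w * cnj w) * conic_eval \<Gamma> t) = t^2 * (4 * conic_trace \<Gamma> * l^2)" .
  hence "complex_of_real (\<sigma> * (cmod w)^2 * conic_eval \<Gamma> t) = complex_of_real (4 * conic_trace \<Gamma> * l^2)"
    using t unfolding of_real_mult complex_norm_square by auto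
  thus ?thesis
    unfolding l_def by (simp only: of_real_eq_iff)
qed

definition contact_conic :: conic where
  "contact_conic = (4 * conic_trace \<Gamma>) *\<^sub>R double_line p w - (\<sigma> * (cmod w)^2) *\<^sub>R \<Gamma>"

lemma is_conic_contact_conic: "is_conic contact_conic"
  using \<Gamma>_circle uvw_nonzero by (simp add: is_conic_iff contact_conic_def conic_quad_double_line)

lemma vertices_on_contact_conic: "t \<in> {a, b, c} \<Longrightarrow> on_conic contact_conic t"
  using \<Gamma>_eval_vertex by (simp add: on_conic_iff contact_conic_def conic_eval_double_line)

lemma contact_conic_tangent:
  assumes "on_conic \<Gamma> z" "collinear {p, q, z}"
  shows "curves_tangent_at \<Gamma> (conic_scale s contact_conic) z"
proof -
  have "Im (cnj w * (z - p)) = 0"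
    using assms(2) by (simp add: collinear_complex_iff w_def complex_eq_iff algebra_simps)
  thus ?thesis
    using assms(1) by (simp add: curves_tangent_at_def on_conic_iff conic_scale_eq_scaleR contact_conic_def
        conic_eval_double_line conic_grad_double_line)
qed

text \<open>The inverse of the projection of \<open>\<Gamma>\<close> from \<open>x\<close> to the unit circle: it is a similarity because both
  curves are circles through \<open>x\<close>.\<close>
definition perspectivity :: "complex \<Rightarrow> complex" where
  "perspectivity = similarity (- (u * v) / \<sigma>) (\<kappa> / \<sigma>)"

lemma perspectivity_eqI:
  fixes \<zeta> :: complex
  shows "\<sigma> * \<zeta> = \<kappa> * z - u * v \<Longrightarrow> perspectivity z = \<zeta>"
  using \<sigma>_nonzero by (simp add: perspectivity_def similarity_def field_simps)

lemma perspectivity_1: "perspectivity 1 = p"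
  by (rule perspectivity_eqI) (simp add: \<kappa>_def \<sigma>_eq u_def v_def algebra_simps)

lemma perspectivity_x: "perspectivity (x * cnj \<kappa> / \<kappa>) = x"
proof (rule perspectivity_eqI)
  have "\<sigma> * x = x * cnj \<kappa> - u * v"
    using x_times_cnj_u unfolding cnj_\<kappa> by algebra
  thus "\<sigma> * x = \<kappa> * (x * cnj \<kappa> / \<kappa>) - u * v"
    using \<kappa>_nonzero by simp
qed

lemma perspectivity_collinear:
  assumes "on_conic \<Gamma> \<zeta>" "\<zeta> \<noteq> x" "z * cnj z = 1" "z \<noteq> x" "collinear {x, \<zeta>, z}"
  shows "perspectivity z = \<zeta>"
proof (rule perspectivity_eqI)
  have "collinear {x, z, \<zeta>}"
    using assms(5) by (simp add: insert_commute)
  hence chord: "\<zeta> + x * z * cnj \<zeta> = x + z"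
    using collinear_unit_chord_iff[OF x_unit assms(3)] assms(4) by simp
  have "\<sigma> * (\<zeta> * cnj \<zeta> - 1) + cnj u * cnj v * \<zeta> + u * v * cnj \<zeta> + u * cnj v + cnj u * v = 0"
    using \<Gamma>_eval[of \<zeta>] assms(1) \<Gamma>_circle by (simp add: on_conic_iff)
  hence "(\<zeta> - x) * (\<sigma> * \<zeta> - (\<kappa> * z - u * v)) = 0"
    using chord x_times_cnj_u unfolding \<kappa>_def by algebra
  thus "\<sigma> * \<zeta> = \<kappa> * z - u * v"
    using assms(2) by simp
qed

definition projected_conic :: "conic \<Rightarrow> conic" where
  "projected_conic K = conic_pullback (- (u * v) / \<sigma>) (\<kappa> / \<sigma>) K"

lemma on_projected_conic: "on_conic (projected_conic K) z \<longleftrightarrow> on_conic K (perspectivity z)"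
  by (simp add: projected_conic_def on_conic_pullback perspectivity_def)

lemma projected_conic_coeffs:
  shows "\<sigma>^2 * conic_quad (projected_conic K) = \<kappa>^2 * conic_quad K"
    and "\<sigma>^2 * conic_lin (projected_conic K)
      = \<kappa> * (\<sigma> * conic_lin K - 2 * conic_quad K * u * v - conic_trace K * cnj u * cnj v)"
  using \<sigma>_nonzero
  by (simp_all add: projected_conic_def power2_eq_square distrib_left right_diff_distrib)

lemma projected_conic_vieta:
  assumes on_K: "on_conic K p" "on_conic K x"
    and z: "\<forall>z\<in>{z1, z2}. z * cnj z = 1 \<and> on_conic K (perspectivity z) \<and> perspectivity z \<notin> {p, x}"
    and "z1 \<noteq> z2"
  shows "cnj (conic_quad K) * cnj \<kappa> = conic_quad K * x * \<kappa> * z1 * z2"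
    and "\<sigma> * conic_lin K - 2 * conic_quad K * u * v - conic_trace K * cnj u * cnj v
      = - conic_quad K * (\<kappa> + x * cnj \<kappa> + \<kappa> * z1 + \<kappa> * z2)"
proof -
  define r where "r = x * cnj \<kappa> / \<kappa>"
  let ?L = "projected_conic K"
  have r: "\<kappa> * r = x * cnj \<kappa>" "perspectivity r = x" "r * cnj r = 1"
    using \<kappa>_nonzero perspectivity_x x_unit by (simp_all add: r_def)
  have "x \<noteq> p"
    using x_unit off_circle by auto
  hence "distinct [1, r, z1, z2]"
    using z \<open>z1 \<noteq> z2\<close> perspectivity_1 r(2) by auto
  moreover have "on_conic ?L s \<and> s * cnj s = 1" if "s \<in> {1, r, z1, z2}" for s
    using on_K z r that by (auto simp: on_projected_conic perspectivity_1)
  ultimately have lin: "conic_lin ?L = - conic_quad ?L * (1 + r + z1 + z2)"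
    and quad: "cnj (conic_quad ?L) = conic_quad ?L * (1 * r * z1 * z2)"
    using conic_unit_circle_vieta[of 1 r z1 z2 ?L] by blast+
  note coeffs = projected_conic_coeffs[of K]
  have "(cnj \<kappa>)^2 * cnj (conic_quad K) = \<sigma>^2 * cnj (conic_quad ?L)"
    using arg_cong[OF coeffs(1), of cnj] by simp
  also have "\<dots> = \<kappa>^2 * conic_quad K * (r * z1 * z2)"
    unfolding quad by (simp flip: coeffs(1))
  also have "\<dots> = \<kappa> * conic_quad K * (x * cnj \<kappa>) * z1 * z2"
    unfolding r(1)[symmetric] by algebra
  finally have "cnj \<kappa> * (cnj (conic_quad K) * cnj \<kappa> - conic_quad K * x * \<kappa> * z1 * z2) = 0"
    by algebra
  thus "cnj (conic_quad K) * cnj \<kappa> = conic_quad K * x * \<kappa> * z1 * z2"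
    using \<kappa>_nonzero by simp
  have "\<kappa> * (\<sigma> * conic_lin K - 2 * conic_quad K * u * v - conic_trace K * cnj u * cnj v
      + conic_quad K * (\<kappa> + x * cnj \<kappa> + \<kappa> * z1 + \<kappa> * z2)) = 0"
    using lin coeffs r(1) by algebra
  thus "\<sigma> * conic_lin K - 2 * conic_quad K * u * v - conic_trace K * cnj u * cnj v
      = - conic_quad K * (\<kappa> + x * cnj \<kappa> + \<kappa> * z1 + \<kappa> * z2)"
    using \<kappa>_nonzero by (simp add: add_eq_0_iff2)
qed

lemma projected_chord_endpoints:
  assumes K: "is_conic K" "fourth_intersection K x" "on_conic K p"
    and z: "\<forall>z\<in>{z1, z2}. z * cnj z = 1 \<and> on_conic K (perspectivity z) \<and> perspectivity z \<notin> {p, x}"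
    and "z1 \<noteq> z2"
  shows "\<kappa> * z1 * z2 = s3 * cnj \<kappa>" and "q + z1 * z2 * cnj q = z1 + z2"
proof -
  let ?\<alpha> = "conic_quad K"
  have "on_conic K x"
    using K(2) by (simp add: fourth_intersection_def)
  note vieta = projected_conic_vieta[OF K(3) this z \<open>z1 \<noteq> z2\<close>]
  note coeffs = fourth_intersection_coeffs[OF K(2)]
  note trace = conic_trace_eq[OF K(2,3) off_circle(1)]
  have \<alpha>: "?\<alpha> \<noteq> 0"
    using conic_quad_nonzero[OF K(2,3) off_circle(1) K(1)] .
  have "?\<alpha> * x * (\<kappa> * z1 * z2 - s3 * cnj \<kappa>) = 0"
    using vieta(1) coeffs(3) by algebra
  thus product: "\<kappa> * z1 * z2 = s3 * cnj \<kappa>"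
    using \<alpha> x_unit by auto
  have "?\<alpha> * (\<kappa> + x * cnj \<kappa> + \<kappa> * z1 + \<kappa> * z2 - 2 * u * v - (s3 * cnj q + x * q) * cnj u * cnj v
      - (x + s1) * \<sigma>) = 0"
    using vieta(2) unfolding trace coeffs(1) by algebra
  hence sum: "\<kappa> + x * cnj \<kappa> + \<kappa> * z1 + \<kappa> * z2 - 2 * u * v - (s3 * cnj q + x * q) * cnj u * cnj v
      - (x + s1) * \<sigma> = 0"
    using \<alpha> by simp
  have "\<kappa> * cnj u * cnj w * (q + z1 * z2 * cnj q - (z1 + z2)) = 0"
    using sum product x_times_cnj_u isogonal s3_times_cnj_w cnj_\<kappa> unfolding \<kappa>_def \<sigma>_eq uvw_defs by algebra
  thus "q + z1 * z2 * cnj q = z1 + z2"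
    using uvw_nonzero \<kappa>_nonzero by simp
qed

lemma conic_grad_at_q: "cnj (conic_grad Q q) = - 2 * conic_quad Q * \<kappa>"
proof -
  interpret swapped: isogonal_pair a b c q p
    by (rule isogonal_pair_swap)
  show ?thesis
    unfolding cnj_conic_grad fourth_intersection_coeffs(1)[OF Q_points(1)]
      swapped.conic_trace_eq[OF Q_points(1,3) off_circle(2)] \<kappa>_def \<sigma>_eq uvw_defs isogonal[symmetric]
    by algebra
qed

lemma chord_tangent_at_q:
  assumes z: "z1 * cnj z1 = 1" "z2 * cnj z2 = 1" "z1 \<noteq> z2"
    and product: "\<kappa> * z1 * z2 = s3 * cnj \<kappa>" and chord: "q + z1 * z2 * cnj q = z1 + z2"
  shows "line_tangent_at z1 z2 Q q"
proof -
  define n where "n = cnj (conic_grad Q q) * (z2 - z1)"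
  have n: "n = - 2 * conic_quad Q * \<kappa> * (z2 - z1)"
    by (simp add: n_def conic_grad_at_q)
  have "z1 * z2 * (n + cnj n) = 0"
  proof -
    have "cnj n = - 2 * cnj (conic_quad Q) * cnj \<kappa> * (cnj z2 - cnj z1)"
      by (simp add: n)
    thus ?thesis
      using n fourth_intersection_coeffs(3)[OF Q_points(1)] product z by algebra
  qed
  hence "Re n = 0"
    using z by (auto simp: complex_add_cnj)
  moreover have "collinear {z1, z2, q}"
    using collinear_unit_chord_iff[OF z] chord by simp
  ultimately show ?thesis
    using Q_points(3) z(3) by (simp add: line_tangent_at_def n_def)
qed

lemma tangent_to_unique_conic:
  assumes "unique_conic5 a b c p z" "is_conic K" "\<forall>t\<in>{a, b, c, p, z}. on_conic K t"
    and "on_conic \<Gamma> z" "collinear {p, q, z}"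
  shows "curves_tangent_at \<Gamma> K p \<and> curves_tangent_at \<Gamma> K z"
proof -
  have tangent: "curves_tangent_at \<Gamma> (conic_scale s contact_conic) p"
    "curves_tangent_at \<Gamma> (conic_scale s contact_conic) z" for s
    using contact_conic_tangent \<Gamma>_points(1) assms(4,5) by (simp_all add: insert_commute)
  have "on_conic contact_conic p" "on_conic contact_conic z"
    using tangent[of 1] by (simp_all add: curves_tangent_at_def conic_scale_eq_scaleR)
  hence "\<forall>t\<in>{a, b, c, p, z}. on_conic contact_conic t"
    using vertices_on_contact_conic by auto
  then obtain s where "K = conic_scale s contact_conic"
    using assms(1-3) is_conic_contact_conic unfolding unique_conic5_def by blast
  thus ?thesis
    using tangent by simp
qed

lemma projected_chord_tangent:
  assumes K: "is_conic K" "\<forall>t\<in>{a, b, c, p, x}. on_conic K t"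
    and \<zeta>: "\<forall>\<zeta>\<in>{\<zeta>1, \<zeta>2}. on_conic \<Gamma> \<zeta> \<and> on_conic K \<zeta> \<and> \<zeta> \<notin> {p, x}"
    and z: "z1 * cnj z1 = 1" "z2 * cnj z2 = 1" "z1 \<noteq> x" "z2 \<noteq> x" "z1 \<noteq> z2"
    and lines: "collinear {x, \<zeta>1, z1}" "collinear {x, \<zeta>2, z2}"
  shows "line_tangent_at z1 z2 Q q"
proof -
  have "perspectivity z1 = \<zeta>1" "perspectivity z2 = \<zeta>2"
    using perspectivity_collinear \<zeta> z lines by auto
  moreover have "fourth_intersection K x"
    using K(2) x_unit x_not_vertex by (simp add: fourth_intersection_def)
  ultimately show ?thesis
    using projected_chord_endpoints[OF K(1), of z1 z2] chord_tangent_at_q K(2) \<zeta> z by simp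
qed

end

theorem theorem1p2:
  fixes A B C P P' D X Y Z :: complex and \<Omega> Q \<Gamma> :: conic
  assumes tri: "\<not> collinear {A, B, C}"
    and Om: "is_circle \<Omega>" "on_conic \<Omega> A" "on_conic \<Omega> B" "on_conic \<Omega> C"
    and Pgen: "\<not> collinear {A, B, P}" "\<not> collinear {B, C, P}" "\<not> collinear {C, A, P}"
              "\<not> on_conic \<Omega> P"
    and iso: "isogonal_conj A B C P P'" and PP': "P \<noteq> P'"
    and Qc: "unique_conic5 A B C P P'" "is_conic Q"
            "on_conic Q A" "on_conic Q B" "on_conic Q C" "on_conic Q P" "on_conic Q P'"
    and Dd: "on_conic \<Omega> D" "on_conic Q D" "D \<notin> {A, B, C}"
    and Xd: "on_conic \<Omega> X" "collinear {D, P, X}" "X \<noteq> D"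
    and Yd: "on_conic \<Omega> Y" "collinear {D, P', Y}" "Y \<noteq> D"
    and Gc: "\<not> collinear {P, X, Y}" "is_circle \<Gamma>"
            "on_conic \<Gamma> P" "on_conic \<Gamma> X" "on_conic \<Gamma> Y"
    and Zd: "on_conic \<Gamma> Z" "collinear {P, P', Z}" "Z \<noteq> P"
  shows
    "(unique_conic5 A B C P Z \<longrightarrow>
       (\<forall>K. is_conic K \<and> on_conic K A \<and> on_conic K B \<and> on_conic K C \<and> on_conic K P \<and> on_conic K Z
            \<longrightarrow> curves_tangent_at \<Gamma> K P \<and> curves_tangent_at \<Gamma> K Z))
     \<and>
     (\<forall>K Z1 Z2 Z1' Z2'.
        unique_conic5 A B C P X \<and> is_conic K \<and>
        on_conic K A \<and> on_conic K B \<and> on_conic K C \<and> on_conic K P \<and> on_conic K X \<and>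
        on_conic \<Gamma> Z1 \<and> on_conic K Z1 \<and> on_conic \<Gamma> Z2 \<and> on_conic K Z2 \<and>
        Z1 \<noteq> Z2 \<and> Z1 \<notin> {P, X} \<and> Z2 \<notin> {P, X} \<and>
        on_conic \<Omega> Z1' \<and> collinear {X, Z1, Z1'} \<and> Z1' \<noteq> X \<and>
        on_conic \<Omega> Z2' \<and> collinear {X, Z2, Z2'} \<and> Z2' \<noteq> X \<and>
        Z1' \<noteq> Z2'
        \<longrightarrow> line_tangent_at Z1' Z2' Q P')"
proof -
  obtain m r where r: "r \<noteq> 0" and D: "similarity m r D = 1"
    and \<Omega>: "\<And>z. on_conic \<Omega> z \<longleftrightarrow> similarity m r z * cnj (similarity m r z) = 1"
    using circle_similar_unit_circle[OF Om(1) Dd(1)] by metis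
  let ?f = "similarity m r" and ?F = "conic_image m r"
  note at_D = similarity_eq_iff[OF r, of m _ D] collinear_similarity[OF r, of m D]
    on_conic_image[OF r, of m _ D]
  note normalize = similarity_invariants[OF r] at_D[unfolded D] \<Omega>[symmetric]
  interpret inscribed_triangle "?f A" "?f B" "?f C"
    using tri Om(2-4) by unfold_locales (simp_all add: normalize)
  interpret isogonal_chords "?f A" "?f B" "?f C" "?f P" "?f P'" "?f X" "?f Y" "?F Q" "?F \<Gamma>"
    using Pgen iso PP' Qc Dd Xd Yd Gc is_circleD[OF Gc(2)] r
    by unfold_locales (auto simp: normalize fourth_intersection_def)
  show ?thesis
  proof ((rule conjI; intro allI impI), goal_cases)
    case (1 K)
    thus ?case
      using tangent_to_unique_conic[of "?f Z" "?F K"] unique_conic5_similarity[OF r] Zd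
      by (simp add: normalize)
  next
    case (2 K Z1 Z2 Z1' Z2')
    thus ?case
      using projected_chord_tangent[of "?F K" "?f Z1" "?f Z2" "?f Z1'" "?f Z2'"]
      by (simp add: normalize)
  qed
qed

end
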